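(* Parallel product surgery is distance preserving for hypergraph product codes: let $\mathcal{Q}$ be a hypergraph product code (a lifted product code over $\mathbb{F}_2$) with check matrices $(H_X,H_Z)$ and distance $d$, and let $\mathcal{P}$ be any hypergraph product code that is a product connection code for $\mathcal{Q}$, with check matrices $(H_X',H_Z')$. Then the minimum weight of the (non-trivial) logical operators, of $X$-type and of $Z$-type, of the merged code with check matrices $$\widetilde{H_X}=\begin{pmatrix}H_X&H_X'\\0&H_X\end{pmatrix},\qquad \widetilde{H_Z}=\begin{pmatrix}H_Z&0\\H_Z'&H_Z\end{pmatrix}$$ is at least $d$.
   Context: Hypergraph product (HGP) code: for $H_a\in\mathbb{F}_2^{m_a\times n_a}$, $H_b\in\mathbb{F}_2^{m_b\times n_b}$, the CSS code with $$H_X=(\,H_a\otimes I_{m_b}\mid I_{m_a}\otimes H_b\,),\qquad H_Z=(\,I_{n_a}\otimes H_b^{\intercal}\mid H_a^{\intercal}\otimes I_{n_b}\,).$$ A product connection code for it is another HGP code built from $H_a'$, $H_b'$ of the same sizes as $H_a$, $H_b$, with check matrices $(H_X',H_Z')$ given by the same formulas. The distance $d$ of $\mathcal{Q}$ is the minimum Hamming weight of a vector in $(\ker H_X\setminus\operatorname{im}H_Z^{\intercal})\cup(\ker H_Z\setminus\operatorname{im}H_X^{\intercal})$. Parallel product surgery ($Z$-type) merges the data patch $\mathcal{Q}$ (first column block) with an auxiliary copy of $\mathcal{Q}$ (second column block). The auxiliary qubits are initialised in $|+\rangle$ and the merged code is treated as a subsystem code in which logical operators supported on the auxiliary patch are gauge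 operators; the $X$-type operators $(0,g)$ on the auxiliary patch with $g\in\ker H_Z$ are fixed gauges (they have known values and act as stabilisers). Accordingly, the logical operators of the merged code are as follows. $Z$-type logical operators: vectors of the form $$\begin{pmatrix}z\\0\end{pmatrix}+\begin{pmatrix}{H_Z'}^{\intercal}\\H_Z^{\intercal}\end{pmatrix}u,\qquad z\in\ker H_X,\ u \text{ arbitrary},$$ and such a vector is non-trivial if it does not lie in $\operatorname{im}\widetilde{H_Z}^{\intercal}$. $X$-type logical operators: vectors in $\ker\widetilde{H_Z}$; such a vector is non-trivial if it does not lie in the span of the rows of $\begin{pmatrix}H_X&H_X'\end{pmatrix}$ and the vectors $(0,g)$ with $g\in\ker H_Z$. *)

theory Defs
  imports "HOL-Analysis.Analysis" "HOL-Library.Z2" "HOL-Library.Extended_Nat"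
begin

text \<open>
  The field of two elements is the type \<^typ>\<open>bit\<close>, and an \<open>m \<times> n\<close> matrix over it has type
  \<open>bit^'n^'m\<close>. Block vectors and block matrices are indexed by sum types, tensor products by
  product types.
\<close>

definition stack :: "'a^'m \<Rightarrow> 'a^'n \<Rightarrow> 'a^('m + 'n)" where
  "stack u v = (\<chi> i. case i of Inl p \<Rightarrow> u $ p | Inr q \<Rightarrow> v $ q)"

text \<open>
  Since a matrix is a vector of rows, \<open>stack A B\<close> is also the block matrix with \<open>A\<close> above \<open>B\<close>.
\<close>

definition beside :: "'a^'m^'r \<Rightarrow> 'a^'n^'r \<Rightarrow> 'a^('m + 'n)^'r" where
  "beside A B = (\<chi> i. stack (A $ i) (B $ i))"

definition kron :: "'a::times^'n^'m \<Rightarrow> 'a^'q^'p \<Rightarrow> 'a^('n \<times> 'q)^('m \<times> 'p)" where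
  "kron A B = (\<chi> i j. A $ fst i $ fst j * B $ snd i $ snd j)"

definition ker :: "bit^'n^'m \<Rightarrow> (bit^'n) set" where
  "ker A = {v. A *v v = 0}"

definition im :: "bit^'n^'m \<Rightarrow> (bit^'m) set" where
  "im A = range (\<lambda>u. A *v u)"

definition hamming_weight :: "bit^'n \<Rightarrow> nat" where
  "hamming_weight v = card {i. v $ i \<noteq> 0}"

text \<open>The minimum over the empty set is \<open>\<infinity>\<close>.\<close>

definition min_weight :: "(bit^'n) set \<Rightarrow> enat" where
  "min_weight S = (INF v\<in>S. enat (hamming_weight v))"

definition css_distance :: "bit^'q^'x \<Rightarrow> bit^'q^'z \<Rightarrow> enat" where
  "css_distance HX HZ =
     min_weight ((ker HX - im (transpose HZ)) \<union> (ker HZ - im (transpose HX)))"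

definition hgp_X ::
  "bit^'na^'ma \<Rightarrow> bit^'nb^'mb \<Rightarrow> bit^(('na \<times> 'mb) + ('ma \<times> 'nb))^('ma \<times> 'mb)" where
  "hgp_X Ha Hb = beside (kron Ha (mat 1)) (kron (mat 1) Hb)"

definition hgp_Z ::
  "bit^'na^'ma \<Rightarrow> bit^'nb^'mb \<Rightarrow> bit^(('na \<times> 'mb) + ('ma \<times> 'nb))^('na \<times> 'nb)" where
  "hgp_Z Ha Hb = beside (kron (mat 1) (transpose Hb)) (kron (transpose Ha) (mat 1))"

definition merged_X :: "bit^'q^'x \<Rightarrow> bit^'q^'x \<Rightarrow> bit^('q + 'q)^('x + 'x)" where
  "merged_X HX HX' = stack (beside HX HX') (beside 0 HX)"

definition merged_Z :: "bit^'q^'z \<Rightarrow> bit^'q^'z \<Rightarrow> bit^('q + 'q)^('z + 'z)" where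
  "merged_Z HZ HZ' = stack (beside HZ 0) (beside HZ' HZ)"

text \<open>
  The merged code is a subsystem code: logical operators of the auxiliary patch (the second
  block) are gauge operators, and the \<open>X\<close>-type operators \<open>stack 0 g\<close> with \<open>g \<in> ker HZ\<close> are fixed
  gauges. Hence the logical operators are not simply the kernels of \<^const>\<open>merged_X\<close> and
  \<^const>\<open>merged_Z\<close> modulo the images of the transposes: the \<open>Z\<close>-type ones are restricted to those
  coming from the data patch, and the fixed gauges count as trivial \<open>X\<close>-type ones.
\<close>

definition merged_Z_logicals ::
  "bit^'q^'x \<Rightarrow> bit^'q^'z \<Rightarrow> bit^'q^'z \<Rightarrow> (bit^('q + 'q)) set" where
  "merged_Z_logicals HX HZ HZ' =
     {stack z 0 + stack (transpose HZ') (transpose HZ) *v u | z u. z \<in> ker HX}"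

definition merged_Z_nontrivial ::
  "bit^'q^'x \<Rightarrow> bit^'q^'z \<Rightarrow> bit^'q^'z \<Rightarrow> (bit^('q + 'q)) set" where
  "merged_Z_nontrivial HX HZ HZ' =
     merged_Z_logicals HX HZ HZ' - im (transpose (merged_Z HZ HZ'))"

definition merged_X_logicals :: "bit^'q^'z \<Rightarrow> bit^'q^'z \<Rightarrow> (bit^('q + 'q)) set" where
  "merged_X_logicals HZ HZ' = ker (merged_Z HZ HZ')"

definition merged_X_nontrivial ::
  "bit^'q^'x \<Rightarrow> bit^'q^'z \<Rightarrow> bit^'q^'x \<Rightarrow> bit^'q^'z \<Rightarrow> (bit^('q + 'q)) set" where
  "merged_X_nontrivial HX HZ HX' HZ' =
     merged_X_logicals HZ HZ' - vec.span (rows (beside HX HX') \<union> {stack 0 g | g. g \<in> ker HZ})"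

lemma transpose_merged_X:
  "transpose (merged_X HX HX') =
     stack (beside (transpose HX) 0) (beside (transpose HX') (transpose HX))"
  by (auto simp: vec_eq_iff transpose_def merged_X_def beside_def stack_def split: sum.splits)

lemma transpose_merged_Z:
  "transpose (merged_Z HZ HZ') =
     stack (beside (transpose HZ) (transpose HZ')) (beside 0 (transpose HZ))"
  by (auto simp: vec_eq_iff transpose_def merged_Z_def beside_def stack_def split: sum.splits)

end

theory Submission
  imports Defs
begin

text \<open>
  For \<open>X\<close>-type operators, a non-trivial one has a data part in \<open>ker HZ\<close> outside the image of
  \<open>HX\<close> transposed, which already has weight at least \<open>d\<close>.

  For \<open>Z\<close>-type operators, read qubit vectors as pairs of matrices \<open>(P, Q)\<close> and check vectors as
  matrices \<open>U\<close>; the transpose of \<open>HZ\<close> maps \<open>U\<close> to \<open>(U Hb\<^sup>T, Ha U)\<close>. If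
  \<open>(P + U Hb'\<^sup>T, Q + Ha' U, U Hb\<^sup>T, Ha U)\<close> has weight below \<open>d\<close>, its first and third components
  occupy a set \<open>I\<close> of fewer than \<open>d\<close> rows, and the other two a set \<open>J\<close> of fewer than \<open>d\<close>
  columns. If neither \<open>Ha\<close> nor \<open>Hb\<close> is surjective, then non-zero vectors of both kernels have
  weight at least \<open>d\<close>, so the kernel codes can be decoded from the erasures \<open>I\<close> and \<open>J\<close>. As the rows
  of \<open>U\<close> outside \<open>I\<close> lie in \<open>ker Hb\<close> and its columns outside \<open>J\<close> lie in \<open>ker Ha\<close>, there is
  \<open>K\<close> in the tensor product of the kernels that agrees with \<open>U\<close> outside \<open>I\<close> and \<open>J\<close>. Adding
  \<open>(K Hb'\<^sup>T, Ha' K)\<close>, which is trivial in the merged code, to \<open>(P, Q)\<close> makes it vanish modulo the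
  ranges of \<open>Ha\<close> and \<open>Hb\<close>, hence a stabiliser. If just one of \<open>Ha\<close>, \<open>Hb\<close> is surjective, only
  one of the two kernels need have a large distance, but also only one of \<open>P\<close>, \<open>Q\<close> can be
  non-trivial, and a suitable \<open>K\<close> exists already for that component.
\<close>

section \<open>Matrix algebra and generalized inverses\<close>

declare transpose_matrix_vector [simp del]

lemma bit_vec_add_self [simp]: "(v :: bit^'n) + v = 0" "(M :: bit^'n^'m) + M = 0"
  by (simp_all add: vec_eq_iff)

lemma bit_add_eq_0_iff: "(M :: bit^'n^'m) + N = 0 \<longleftrightarrow> M = N"
  by (metis add_right_cancel bit_vec_add_self(2))

lemma matrix_mult_0_left [simp]: "0 ** (M :: 'a::semiring_1^'n^'m) = 0"
  and matrix_mult_0_right [simp]: "(M :: 'a::semiring_1^'n^'m) ** 0 = 0"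
  by (simp_all add: vec_eq_iff matrix_matrix_mult_def)

lemma transpose_add: "transpose (A + B :: 'a::plus^'n^'m) = transpose A + transpose B"
  by (simp add: vec_eq_iff transpose_def)

lemma transpose_0 [simp]: "transpose 0 = 0"
  by (simp add: vec_eq_iff transpose_def)

lemma matrix_add_rdistrib: "(A + B) ** C = A ** C + B ** C"
  for A :: "'a::semiring_1^'n^'m"
  by (simp add: vec_eq_iff matrix_matrix_mult_def distrib_right sum.distrib)

lemma mult_axis: "A *v axis e 1 = column e A"
  for A :: "'a::semiring_1^'n^'m"
  by (simp add: vec_eq_iff matrix_vector_mult_def axis_def column_def if_distrib cong: if_cong)

lemma mult_transpose_row:
  fixes B :: "'a::comm_semiring_1^'n^'m"
  shows "(M ** transpose B) $ i = B *v (M $ i)"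
  by (simp add: vec_eq_iff matrix_matrix_mult_def matrix_vector_mult_def transpose_def mult.commute)

text \<open>A right inverse of \<open>A\<close> on its range extends linearly to the whole space.
  Then \<open>A ** G\<close> projects onto the range, so surjectivity of \<open>A\<close> becomes
  the identity \<open>A ** G = mat 1\<close>.\<close>

lemma generalized_inverse_exists:
  fixes A :: "'a::field^'n^'m"
  obtains G where "A ** G ** A = A"
proof -
  have "Vector_Spaces.linear (*s) (*s) ((*v) A)" by (rule matrix_vector_mul_linear_gen)
  from vec.linear_exists_right_inverse_on[OF this vec.subspace_UNIV]
  obtain g where g: "Vector_Spaces.linear (*s) (*s) g" "\<And>v. A *v (g (A *v v)) = A *v v"
    by blast
  have "A ** matrix g ** A = A"
    unfolding matrix_eq by (simp add: matrix_vector_mul_assoc[symmetric] matrix_works[OF g(1)] g(2))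
  then show thesis by (rule that)
qed

section \<open>Block vectors and tensor products\<close>

definition vec_of :: "'a^'n^'m \<Rightarrow> 'a^('m \<times> 'n)" where
  "vec_of M = (\<chi> p. M $ fst p $ snd p)"

lemma vec_of_surj: obtains M where "v = vec_of M"
  by (rule that[of "\<chi> i j. v $ (i, j)"]) (simp add: vec_of_def vec_eq_iff)

lemma stack_surj: obtains u v where "w = stack u v"
  by (rule that[of "\<chi> i. w $ Inl i" "\<chi> i. w $ Inr i"])
    (simp add: stack_def vec_eq_iff split: sum.split)

lemma vec_of_eq_iff [simp]: "vec_of M = vec_of N \<longleftrightarrow> M = N"
  by (simp add: vec_of_def vec_eq_iff)

lemma vec_of_0 [simp]: "vec_of 0 = 0"
  by (simp add: vec_of_def vec_eq_iff)

lemma vec_of_eq_0_iff [simp]: "vec_of M = 0 \<longleftrightarrow> M = 0"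
  by (simp add: vec_of_def vec_eq_iff)

lemma vec_of_add: "vec_of (M + N) = vec_of M + vec_of N"
  by (simp add: vec_of_def vec_eq_iff)

lemma stack_eq_iff [simp]: "stack u v = stack u' v' \<longleftrightarrow> u = u' \<and> v = v'"
  by (auto simp: stack_def vec_eq_iff split: sum.split)

lemma stack_eq_0_iff [simp]: "stack u v = 0 \<longleftrightarrow> u = 0 \<and> v = 0"
  by (auto simp: stack_def vec_eq_iff split: sum.split)

lemma stack_add: "stack u v + stack u' v' = stack (u + u') (v + v')"
  by (simp add: stack_def vec_eq_iff split: sum.split)

lemma sum_UNIV_sum_type:
  "(\<Sum>x\<in>UNIV. f x) = (\<Sum>x\<in>UNIV. f (Inl x)) + (\<Sum>x\<in>UNIV. f (Inr x))"
  for f :: "'m::finite + 'n::finite \<Rightarrow> 'a::comm_monoid_add"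
  using sum.Plus[of UNIV UNIV f] by (simp add: comp_def)

lemma beside_mult_stack: "beside A B *v stack u v = A *v u + B *v v"
  by (simp add: beside_def stack_def vec_eq_iff matrix_vector_mult_def sum_UNIV_sum_type)

lemma stack_mult: "stack A B *v u = stack (A *v u) (B *v u)"
  by (simp add: stack_def vec_eq_iff matrix_vector_mult_def split: sum.split)

lemma transpose_beside: "transpose (beside A B) = stack (transpose A) (transpose B)"
  by (auto simp: vec_eq_iff transpose_def beside_def stack_def split: sum.splits)

lemma transpose_kron: "transpose (kron A B) = kron (transpose A) (transpose B)"
  by (simp add: vec_eq_iff transpose_def kron_def)

lemma kron_mult_vec_of:
  fixes A :: "'a::comm_semiring_1^'n^'m"
  shows "kron A B *v vec_of M = vec_of (A ** M ** transpose B)"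
proof -
  have "(\<Sum>p\<in>UNIV. A $ i $ fst p * B $ j $ snd p * M $ fst p $ snd p) =
      (\<Sum>l\<in>UNIV. (\<Sum>k\<in>UNIV. A $ i $ k * M $ k $ l) * B $ j $ l)" for i j
  proof -
    have "(\<Sum>p\<in>UNIV. A $ i $ fst p * B $ j $ snd p * M $ fst p $ snd p) =
        (\<Sum>k\<in>UNIV. \<Sum>l\<in>UNIV. A $ i $ k * B $ j $ l * M $ k $ l)"
      unfolding UNIV_Times_UNIV[symmetric] sum.cartesian_product by (simp add: case_prod_unfold)
    also have "\<dots> = (\<Sum>l\<in>UNIV. \<Sum>k\<in>UNIV. A $ i $ k * B $ j $ l * M $ k $ l)"
      by (rule sum.swap)
    finally show ?thesis by (simp add: sum_distrib_left sum_distrib_right mult_ac)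
  qed
  then show ?thesis
    by (simp add: vec_eq_iff kron_def vec_of_def matrix_vector_mult_def matrix_matrix_mult_def
        transpose_def)
qed

lemma hgp_X_mult:
  "hgp_X Ha Hb *v stack (vec_of P) (vec_of Q) = vec_of (Ha ** P + Q ** transpose Hb)"
  by (simp add: hgp_X_def beside_mult_stack kron_mult_vec_of vec_of_add)

lemma transpose_hgp_Z_mult:
  "transpose (hgp_Z Ha Hb) *v vec_of U = stack (vec_of (U ** transpose Hb)) (vec_of (Ha ** U))"
  by (simp add: hgp_Z_def transpose_beside transpose_kron stack_mult kron_mult_vec_of)

text \<open>With \<open>a\<close> read as a matrix \<open>M\<close>, each side is the sum of
  \<open>transpose Ha ** M ** Hb'\<close> and \<open>transpose Ha' ** M ** Hb\<close>.\<close>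

lemma hgp_commute:
  "hgp_Z Ha' Hb' *v (transpose (hgp_X Ha Hb) *v a) = hgp_Z Ha Hb *v (transpose (hgp_X Ha' Hb') *v a)"
proof -
  obtain M where a: "a = vec_of M" by (rule vec_of_surj)
  show ?thesis
    by (simp add: a hgp_Z_def hgp_X_def transpose_beside transpose_kron stack_mult
      beside_mult_stack kron_mult_vec_of vec_of_add[symmetric] matrix_mul_assoc add.commute)
qed

section \<open>Hamming weights\<close>

lemma hamming_weight_stack: "hamming_weight (stack u v) = hamming_weight u + hamming_weight v"
proof -
  have eq: "{i. stack u v $ i \<noteq> 0} = Inl ` {i. u $ i \<noteq> 0} \<union> Inr ` {i. v $ i \<noteq> 0}"
  proof (rule set_eqI)
    show "i \<in> {i. stack u v $ i \<noteq> 0} \<longleftrightarrow> i \<in> Inl ` {i. u $ i \<noteq> 0} \<union> Inr ` {i. v $ i \<noteq> 0}" for i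
      by (cases i) (auto simp: stack_def)
  qed
  then show ?thesis
    unfolding hamming_weight_def by (subst eq, subst card_Un_disjoint) (auto simp: card_image)
qed

lemma hamming_weight_0 [simp]: "hamming_weight 0 = 0"
  by (simp add: hamming_weight_def)

lemma card_nonzero_rows_le: "card {i. M $ i \<noteq> 0} \<le> hamming_weight (vec_of M)"
proof -
  have "{i. M $ i \<noteq> 0} \<subseteq> fst ` {p. vec_of M $ p \<noteq> 0}"
    by (force simp: vec_of_def vec_eq_iff image_iff)
  then show ?thesis unfolding hamming_weight_def by (meson surj_card_le finite)
qed

lemma card_nonzero_columns_le: "card {j. transpose M $ j \<noteq> 0} \<le> hamming_weight (vec_of M)"
proof -
  have "{j. transpose M $ j \<noteq> 0} \<subseteq> snd ` {p. vec_of M $ p \<noteq> 0}"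
    by (force simp: vec_of_def vec_eq_iff image_iff transpose_def)
  then show ?thesis unfolding hamming_weight_def by (meson surj_card_le finite)
qed

lemma hamming_weight_outer_row:
  "hamming_weight (vec_of (\<chi> i. if i = e then k else 0)) = hamming_weight k"
proof -
  have "{p. vec_of (\<chi> i. if i = e then k else 0) $ p \<noteq> 0} = Pair e ` {j. k $ j \<noteq> 0}"
    by (auto simp: vec_of_def image_iff split: if_splits)
  then show ?thesis by (simp add: hamming_weight_def card_image inj_on_def)
qed

lemma hamming_weight_vec_of_transpose:
  "hamming_weight (vec_of (transpose M)) = hamming_weight (vec_of M)"
  unfolding hamming_weight_def
  by (rule bij_betw_same_card[of prod.swap], rule bij_betw_byWitness[of _ prod.swap])
    (auto simp: vec_of_def transpose_def)

section \<open>Distances of the classical codes\<close>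

lemma im_transpose_hgp_Z:
  "stack (vec_of P) (vec_of Q) \<in> im (transpose (hgp_Z Ha Hb)) \<longleftrightarrow>
    (\<exists>U. P = U ** transpose Hb \<and> Q = Ha ** U)"
proof
  assume "stack (vec_of P) (vec_of Q) \<in> im (transpose (hgp_Z Ha Hb))"
  then obtain u where u: "stack (vec_of P) (vec_of Q) = transpose (hgp_Z Ha Hb) *v u"
    by (auto simp: im_def)
  obtain U where "u = vec_of U" by (rule vec_of_surj)
  with u show "\<exists>U. P = U ** transpose Hb \<and> Q = Ha ** U"
    by (auto simp: transpose_hgp_Z_mult)
next
  assume "\<exists>U. P = U ** transpose Hb \<and> Q = Ha ** U"
  then show "stack (vec_of P) (vec_of Q) \<in> im (transpose (hgp_Z Ha Hb))"
    unfolding im_def by (metis rangeI transpose_hgp_Z_mult)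
qed

lemma css_distance_le:
  assumes "v \<in> ker HX" "v \<notin> im (transpose HZ)"
  shows "css_distance HX HZ \<le> hamming_weight v"
  unfolding css_distance_def min_weight_def using assms by (intro INF_lower) auto

text \<open>If every unit vector were in the range, the projection \<open>A ** G\<close> would fix
  them all.\<close>

lemma generalized_inverse_axis:
  fixes A :: "'a::field^'n^'m"
  assumes "A ** G ** A = A" "A ** G \<noteq> mat 1"
  obtains e where "\<And>x. A *v x \<noteq> axis e 1"
proof -
  have "A ** G = mat 1" if "\<And>e. A ** G *v axis e 1 = axis e 1"
  proof -
    have "column e (A ** G) = column e (mat 1)" for e
      using that[of e] by (simp add: mult_axis[symmetric])
    then show ?thesis by (simp add: column_def vec_eq_iff)
  qed
  then obtain e where e: "A ** G *v axis e 1 \<noteq> axis e 1"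
    using assms(2) by blast
  have "A *v x \<noteq> axis e 1" for x
    using e assms(1) by (metis matrix_vector_mul_assoc)
  then show thesis by (rule that)
qed

text \<open>Placing \<open>k\<close> in row \<open>e\<close> of the second block, with
  \<open>axis e 1\<close> outside the range of \<open>Ha\<close>, gives a non-trivial logical
  operator of the same weight.\<close>

lemma css_distance_le_ker_b:
  fixes Ha :: "bit^'na^'ma" and Hb :: "bit^'nb^'mb"
  assumes "Ha ** G ** Ha = Ha" "Ha ** G \<noteq> mat 1" "Hb *v k = 0" "k \<noteq> 0"
  shows "css_distance (hgp_X Ha Hb) (hgp_Z Ha Hb) \<le> hamming_weight k"
proof -
  obtain e where e: "\<And>x. Ha *v x \<noteq> axis e 1"
    using generalized_inverse_axis[OF assms(1,2)] by blast
  define Q :: "bit^'nb^'ma" where "Q = (\<chi> i. if i = e then k else 0)"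
  let ?v = "stack (vec_of (0 :: bit^'mb^'na)) (vec_of Q)"
  have "Q ** transpose Hb = 0"
    using assms(3) by (subst vec_eq_iff) (simp add: mult_transpose_row Q_def)
  then have "?v \<in> ker (hgp_X Ha Hb)"
    by (simp add: ker_def hgp_X_mult del: vec_of_0)
  moreover have "?v \<notin> im (transpose (hgp_Z Ha Hb))"
  proof
    assume "?v \<in> im (transpose (hgp_Z Ha Hb))"
    then obtain U where Q: "Q = Ha ** U"
      unfolding im_transpose_hgp_Z by blast
    \<comment> \<open>Wherever \<open>k\<close> is non-zero, the column of \<open>Q\<close> is
      \<open>axis e 1\<close>.\<close>
    obtain j where j: "k $ j \<noteq> 0" using assms(4) by (auto simp: vec_eq_iff)
    have "Ha *v column j U = column j Q"
      by (simp add: Q column_def vec_eq_iff matrix_vector_mult_def matrix_matrix_mult_def)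
    also have "\<dots> = axis e 1"
      using j by (simp add: Q_def column_def vec_eq_iff axis_def)
    finally show False using e by blast
  qed
  ultimately show ?thesis
    using css_distance_le[of ?v] by (simp add: hamming_weight_stack Q_def hamming_weight_outer_row)
qed

text \<open>Mirror image: \<open>k\<close> is placed in a column of the first block, whose transpose
  is \<open>P\<close>.\<close>

lemma css_distance_le_ker_a:
  fixes Ha :: "bit^'na^'ma" and Hb :: "bit^'nb^'mb"
  assumes "Hb ** G ** Hb = Hb" "Hb ** G \<noteq> mat 1" "Ha *v k = 0" "k \<noteq> 0"
  shows "css_distance (hgp_X Ha Hb) (hgp_Z Ha Hb) \<le> hamming_weight k"
proof -
  obtain e where e: "\<And>x. Hb *v x \<noteq> axis e 1"
    using generalized_inverse_axis[OF assms(1,2)] by blast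
  define P :: "bit^'na^'mb" where "P = (\<chi> i. if i = e then k else 0)"
  let ?v = "stack (vec_of (transpose P)) (vec_of (0 :: bit^'nb^'ma))"
  have "P ** transpose Ha = 0"
    using assms(3) by (subst vec_eq_iff) (simp add: mult_transpose_row P_def)
  then have "Ha ** transpose P = 0"
    by (metis matrix_transpose_mul transpose_transpose transpose_0)
  then have "?v \<in> ker (hgp_X Ha Hb)"
    by (simp add: ker_def hgp_X_mult del: vec_of_0)
  moreover have "?v \<notin> im (transpose (hgp_Z Ha Hb))"
  proof
    assume "?v \<in> im (transpose (hgp_Z Ha Hb))"
    then obtain U where "transpose P = U ** transpose Hb"
      unfolding im_transpose_hgp_Z by blast
    then have P: "P = Hb ** transpose U"
      by (metis matrix_transpose_mul transpose_transpose)
    obtain j where j: "k $ j \<noteq> 0" using assms(4) by (auto simp: vec_eq_iff)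
    have "Hb *v column j (transpose U) = column j P"
      by (simp add: P column_def vec_eq_iff matrix_vector_mult_def matrix_matrix_mult_def)
    also have "\<dots> = axis e 1"
      using j by (simp add: P_def column_def vec_eq_iff axis_def)
    finally show False using e by blast
  qed
  ultimately show ?thesis
    using css_distance_le[of ?v]
    by (simp add: hamming_weight_stack hamming_weight_vec_of_transpose P_def hamming_weight_outer_row)
qed

section \<open>Trivial logical operators of the data patch\<close>

text \<open>The cycle condition says that \<open>transpose B\<close> kills the defect
  \<open>A ** (X + Y)\<close>. A lift \<open>V\<close> of this defect through \<open>A\<close> turns
  \<open>A ** X\<close> into \<open>A ** Y\<close> without changing
  \<open>X ** transpose B\<close>.\<close>

lemma cycle_in_ranges_is_boundary:
  fixes A :: "bit^'na^'ma" and B :: "bit^'nb^'mb"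
  assumes "A ** P + Q ** transpose B = 0" "P = X ** transpose B" "Q = A ** Y"
  obtains W where "P = W ** transpose B" "Q = A ** W"
proof -
  obtain G where G: "A ** G ** A = A" by (rule generalized_inverse_exists)
  define V where "V = G ** (A ** (X + Y))"
  have "A ** (X + Y) ** transpose B = 0"
    using assms by (simp add: matrix_add_ldistrib matrix_add_rdistrib matrix_mul_assoc)
  then have 1: "V ** transpose B = 0"
    by (simp add: V_def matrix_mul_assoc[symmetric])
  have "A ** V = A ** (X + Y)"
    by (simp add: V_def matrix_mul_assoc G)
  then have "A ** (X + V) = A ** X + (A ** X + Q)"
    by (simp add: matrix_add_ldistrib assms(3))
  then have "A ** (X + V) = Q"
    by (simp add: add.assoc[symmetric])
  moreover have "(X + V) ** transpose B = P"
    by (simp add: matrix_add_rdistrib 1 assms(2))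
  ultimately show thesis by (intro that[of "X + V"]) auto
qed

lemma rows_in_ker_eq_0:
  fixes B :: "bit^'nb^'mb" and D :: "bit^'nb^'l"
  assumes inj: "\<forall>k. B *v k = 0 \<longrightarrow> D *v k = 0 \<longrightarrow> k = 0"
    and "R ** transpose B = 0" "R ** transpose D = 0"
  shows "R = (0 :: bit^'nb^'r)"
proof -
  have "R $ i = 0" for i
    using assms(2,3)[THEN arg_cong[where f = "\<lambda>M. M $ i"]]
    by (intro inj[rule_format]) (simp_all add: mult_transpose_row)
  then show ?thesis by (simp add: vec_eq_iff)
qed

text \<open>A decoder for the code \<open>ker A\<close>: \<open>L\<close> recovers a codeword from
  what \<open>D\<close> keeps of it, and outputs only codewords.\<close>

lemma left_inverse_on_ker:
  fixes A :: "bit^'n^'m" and D :: "bit^'n^'l"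
  assumes inj: "\<forall>k. A *v k = 0 \<longrightarrow> D *v k = 0 \<longrightarrow> k = 0"
  obtains L where "A ** L = 0" "\<And>M :: bit^'k^'n. A ** M = 0 \<Longrightarrow> L ** (D ** M) = M"
proof -
  obtain G where G: "A ** G ** A = A" by (rule generalized_inverse_exists)
  \<comment> \<open>In characteristic 2 this is \<open>1 - G A\<close>, a projection onto \<open>ker A\<close>.\<close>
  define F where "F = mat 1 + G ** A"
  have AF: "A ** F = 0"
    by (simp add: F_def matrix_add_ldistrib matrix_mul_assoc G)
  obtain Y where Y: "(D ** F) ** Y ** (D ** F) = D ** F" by (rule generalized_inverse_exists)
  \<comment> \<open>\<open>Z\<close> measures how far \<open>F ** Y ** D\<close> is from the
    identity on \<open>ker A\<close>. Its columns lie in \<open>ker A\<close> and are killed by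
    \<open>D\<close>.\<close>
  define Z where "Z = F + F ** Y ** (D ** F)"
  have "transpose Z = 0"
  proof (rule rows_in_ker_eq_0[OF inj])
    have "A ** Z = 0"
      by (simp add: Z_def matrix_add_ldistrib matrix_mul_assoc AF)
    then show "transpose Z ** transpose A = 0"
      by (metis matrix_transpose_mul transpose_0)
    have "D ** Z = 0"
      using Y by (simp add: Z_def matrix_add_ldistrib matrix_mul_assoc)
    then show "transpose Z ** transpose D = 0"
      by (metis matrix_transpose_mul transpose_0)
  qed
  then have "Z = 0" by (metis transpose_0 transpose_transpose)
  then have FY: "F ** Y ** (D ** F) = F"
    unfolding Z_def bit_add_eq_0_iff by simp
  have "(F ** Y) ** (D ** M) = M" if "A ** M = 0" for M :: "bit^'k^'n"
  proof -
    have "F ** M = M"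
      by (simp add: F_def matrix_add_rdistrib matrix_mul_assoc[symmetric] that)
    then show ?thesis by (metis FY matrix_mul_assoc)
  qed
  moreover have "A ** (F ** Y) = 0"
    by (simp add: matrix_mul_assoc AF)
  ultimately show thesis by (rule that[rotated])
qed

section \<open>Removing the auxiliary part\<close>

text \<open>
  No distance is assumed for \<open>A\<close>: \<open>U\<close> only has to be matched modulo the vectors of \<open>ker A\<close> which \<open>A'\<close>
  sends into the range of \<open>A\<close>, and a generalized inverse of \<open>A'\<close> modulo that range does so.
\<close>

lemma exists_gauge_correction_one_side:
  fixes A A' :: "bit^'na^'ma" and B :: "bit^'nb^'mb" and D :: "bit^'nb^'l"
  assumes inj: "\<forall>k. B *v k = 0 \<longrightarrow> D *v k = 0 \<longrightarrow> k = 0"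
    and z: "A ** P + Q ** transpose B = 0"
    and U: "A ** U ** transpose D = 0" "(Q + A' ** U) ** transpose D = 0"
  obtains K Y where "A ** K = 0" "K ** transpose B = 0" "Q + A' ** K = A ** Y"
proof -
  obtain G where G: "A ** G ** A = A" by (rule generalized_inverse_exists)
  \<comment> \<open>\<open>E\<close> projects onto \<open>ker A\<close>, and the kernel of
    \<open>C\<close> is the range of \<open>A\<close>. So \<open>N\<close> below is
    \<open>A'\<close> as a map from \<open>ker A\<close> to the quotient by that range.\<close>
  define E where "E = mat 1 + G ** A"
  define C where "C = mat 1 + A ** G"
  have AE: "A ** E = 0" by (simp add: E_def matrix_add_ldistrib matrix_mul_assoc G)
  have CA: "C ** A = 0" by (simp add: C_def matrix_add_rdistrib matrix_mul_assoc G)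
  define N where "N = C ** A' ** E"
  obtain Y where Y: "N ** Y ** N = N" by (rule generalized_inverse_exists)
  define R where "R = C ** Q"
  have "Q ** transpose B = A ** P" using z by (simp add: bit_add_eq_0_iff)
  then have RB: "R ** transpose B = 0"
    by (metis R_def CA matrix_mul_assoc matrix_mult_0_left)
  have EU: "E ** U ** transpose D = U ** transpose D"
    by (simp add: E_def matrix_add_rdistrib matrix_mul_assoc[symmetric] U(1)[unfolded matrix_mul_assoc[symmetric]])
  have "Q ** transpose D = A' ** U ** transpose D"
    using U(2) by (simp add: bit_add_eq_0_iff matrix_add_rdistrib)
  then have RD: "R ** transpose D = N ** U ** transpose D"
    by (metis R_def N_def EU matrix_mul_assoc)
  \<comment> \<open>\<open>N ** Y\<close> fixes the range of \<open>N\<close>, which contains the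
    columns of \<open>R ** transpose D\<close>.\<close>
  have "R + N ** Y ** R = 0"
  proof (rule rows_in_ker_eq_0[OF inj])
    show "(R + N ** Y ** R) ** transpose B = 0"
      by (simp add: matrix_add_rdistrib matrix_mul_assoc[symmetric] RB)
    have "N ** Y ** R ** transpose D = R ** transpose D"
      by (metis RD Y matrix_mul_assoc)
    then show "(R + N ** Y ** R) ** transpose D = 0"
      by (simp add: matrix_add_rdistrib)
  qed
  then have R: "N ** Y ** R = R" by (simp add: bit_add_eq_0_iff)
  \<comment> \<open>\<open>Y ** R\<close> is a preimage of \<open>R\<close> under \<open>N\<close>;
    \<open>E\<close> moves its columns into \<open>ker A\<close>, while the rows stay in
    \<open>ker B\<close>.\<close>
  define K where "K = E ** Y ** R"
  have "C ** (Q + A' ** K) = R + N ** Y ** R"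
    by (simp add: matrix_add_ldistrib K_def N_def R_def matrix_mul_assoc)
  then have "C ** (Q + A' ** K) = 0" by (simp add: R)
  then have "Q + A' ** K = A ** (G ** (Q + A' ** K))"
    by (simp add: C_def matrix_add_rdistrib bit_add_eq_0_iff matrix_mul_assoc)
  moreover have "A ** K = 0" by (simp add: K_def matrix_mul_assoc AE)
  moreover have "K ** transpose B = 0" by (simp add: K_def matrix_mul_assoc[symmetric] RB)
  ultimately show thesis by (intro that)
qed

text \<open>\<open>U ** transpose D'\<close> has its columns in \<open>ker A\<close> and
  \<open>D ** U\<close> has its rows in \<open>ker B\<close>, so each can be handed to a
  decoder.\<close>

lemma exists_ker_product_agreeing:
  fixes A :: "bit^'na^'ma" and B :: "bit^'nb^'mb" and D :: "bit^'na^'k" and D' :: "bit^'nb^'l"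
  assumes injA: "\<forall>k. A *v k = 0 \<longrightarrow> D *v k = 0 \<longrightarrow> k = 0"
    and injB: "\<forall>k. B *v k = 0 \<longrightarrow> D' *v k = 0 \<longrightarrow> k = 0"
    and U: "D ** (U ** transpose B) = 0" "A ** U ** transpose D' = 0"
  obtains K where "A ** K = 0" "K ** transpose B = 0"
    "D ** K = D ** U" "K ** transpose D' = U ** transpose D'"
proof -
  obtain L where L: "A ** L = 0" "\<And>M :: bit^'l^'na. A ** M = 0 \<Longrightarrow> L ** (D ** M) = M"
    using left_inverse_on_ker[OF injA] by blast
  obtain L' where L': "B ** L' = 0" "\<And>M :: bit^'k^'nb. B ** M = 0 \<Longrightarrow> L' ** (D' ** M) = M"
    using left_inverse_on_ker[OF injB] by blast
  have 1: "L ** D ** U ** transpose D' = U ** transpose D'"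
    using L(2)[of "U ** transpose D'"] U(2) by (simp add: matrix_mul_assoc)
  have "B ** transpose (D ** U) = 0"
    using U(1) by (metis matrix_transpose_mul transpose_transpose transpose_0 matrix_mul_assoc)
  from L'(2)[OF this] have 2: "D ** U ** transpose D' ** transpose L' = D ** U"
    by (metis matrix_transpose_mul transpose_transpose)
  have L'B: "transpose L' ** transpose B = 0"
    by (metis L'(1) matrix_transpose_mul transpose_0)
  define K where "K = U ** transpose D' ** transpose L'"
  \<comment> \<open>Row and column decoding agree: both give
    \<open>L ** D ** U ** transpose D' ** transpose L'\<close>.\<close>
  have K: "K = L ** (D ** U)"
    by (metis 1 2 K_def matrix_mul_assoc)
  show thesis
  proof (rule that)
    show "A ** K = 0" by (simp add: K matrix_mul_assoc L(1))
    show "K ** transpose B = 0" by (simp add: K_def matrix_mul_assoc[symmetric] L'B)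
    show "D ** K = D ** U" by (simp add: K_def matrix_mul_assoc 2)
    show "K ** transpose D' = U ** transpose D'" by (simp add: K matrix_mul_assoc 1)
  qed
qed

text \<open>Modulo the range of \<open>A\<close>, the rows of \<open>Q + A' ** K\<close> lie in
  \<open>ker B\<close> and are killed by \<open>D\<close>, hence vanish.\<close>

lemma corrected_in_range:
  fixes A A' :: "bit^'na^'ma" and B :: "bit^'nb^'mb" and D :: "bit^'nb^'l"
  assumes inj: "\<forall>k. B *v k = 0 \<longrightarrow> D *v k = 0 \<longrightarrow> k = 0"
    and z: "A ** P + Q ** transpose B = 0"
    and K: "K ** transpose B = 0" "(Q + A' ** K) ** transpose D = 0"
  obtains Y where "Q + A' ** K = A ** Y"
proof -
  obtain G where G: "A ** G ** A = A" by (rule generalized_inverse_exists)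
  define C where "C = mat 1 + A ** G"
  have CA: "C ** A = 0" by (simp add: C_def matrix_add_rdistrib matrix_mul_assoc G)
  have "Q ** transpose B = A ** P" using z by (simp add: bit_add_eq_0_iff)
  then have "(Q + A' ** K) ** transpose B = A ** P"
    by (simp add: matrix_add_rdistrib matrix_mul_assoc[symmetric] K(1))
  then have "C ** (Q + A' ** K) ** transpose B = 0"
    by (metis CA matrix_mul_assoc matrix_mult_0_left)
  moreover have "C ** (Q + A' ** K) ** transpose D = 0"
    by (simp add: matrix_mul_assoc[symmetric] K(2))
  ultimately have "C ** (Q + A' ** K) = 0"
    using rows_in_ker_eq_0[OF inj] by blast
  then have "Q + A' ** K = A ** (G ** (Q + A' ** K))"
    by (simp add: C_def matrix_add_rdistrib bit_add_eq_0_iff matrix_mul_assoc)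
  then show thesis by (rule that)
qed

section \<open>Erasures and \<open>Z\<close>-type operators of low weight\<close>

definition erase_coords :: "'n set \<Rightarrow> bit^'n^'n" where
  "erase_coords S = (\<chi> i j. if i = j \<and> i \<notin> S then 1 else 0)"

lemma transpose_erase_coords [simp]: "transpose (erase_coords S) = erase_coords S"
  by (auto simp: erase_coords_def transpose_def vec_eq_iff)

lemma erase_coords_mult_vec: "erase_coords S *v k = (\<chi> i. if i \<in> S then 0 else k $ i)"
proof -
  have "(if i = j \<and> i \<notin> S then 1 else 0) * k $ j = (if i = j then if i \<in> S then 0 else k $ j else 0)"
    for i j by simp
  then show ?thesis
    by (simp add: erase_coords_def vec_eq_iff matrix_vector_mult_def)
qed

lemma erase_coords_mult_eq_0:
  assumes "\<And>i. M $ i \<noteq> 0 \<Longrightarrow> i \<in> S"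
  shows "erase_coords S ** M = 0"
proof -
  have "erase_coords S $ i $ j * M $ j $ l = 0" for i j l
    using assms by (cases "M $ j = 0") (auto simp: erase_coords_def)
  then have "(erase_coords S ** M) $ i $ l = 0" for i l
    unfolding matrix_matrix_mult_def vec_lambda_beta by (intro sum.neutral) blast
  then show ?thesis
    by (simp add: vec_eq_iff)
qed

lemma mult_erase_coords_eq_0:
  assumes "\<And>j. transpose M $ j \<noteq> 0 \<Longrightarrow> j \<in> S"
  shows "M ** erase_coords S = 0"
  by (metis erase_coords_mult_eq_0[OF assms] matrix_transpose_mul transpose_erase_coords
      transpose_transpose transpose_0)

lemma erase_coords_inj_on_ker:
  assumes dist: "\<And>k. A *v k = 0 \<Longrightarrow> k \<noteq> 0 \<Longrightarrow> d \<le> enat (hamming_weight k)"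
    and "enat (card S) < d" "A *v k = 0" "erase_coords S *v k = 0"
  shows "k = 0"
proof (rule ccontr)
  assume "k \<noteq> 0"
  have "{i. k $ i \<noteq> 0} \<subseteq> S"
    using assms(4) by (auto simp: erase_coords_mult_vec vec_eq_iff split: if_splits)
  then have "hamming_weight k \<le> card S"
    unfolding hamming_weight_def by (simp add: card_mono)
  with dist[OF assms(3) \<open>k \<noteq> 0\<close>] assms(2) show False
    by (meson enat_ord_simps(1) leD order_trans)
qed

text \<open>The matrices \<open>W\<close> and \<open>U + K\<close> will be the coefficients that
  express the operator by the merged checks.\<close>

lemma merged_Z_low_weight_trivial:
  fixes Ha Ha' :: "bit^'na^'ma" and Hb Hb' :: "bit^'nb^'mb"
  assumes z: "Ha ** P + Q ** transpose Hb = 0"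
    and weight: "enat (hamming_weight (vec_of (P + U ** transpose Hb'))
        + hamming_weight (vec_of (Q + Ha' ** U))
        + hamming_weight (vec_of (U ** transpose Hb)) + hamming_weight (vec_of (Ha ** U)))
      < css_distance (hgp_X Ha Hb) (hgp_Z Ha Hb)" (is "_ < ?d")
  obtains K W where "Ha ** K = 0" "K ** transpose Hb = 0"
    "P + K ** transpose Hb' = W ** transpose Hb" "Q + Ha' ** K = Ha ** W"
proof -
  let ?P = "P + U ** transpose Hb'" and ?A = "U ** transpose Hb"
  let ?Q = "Q + Ha' ** U" and ?B = "Ha ** U"
  \<comment> \<open>Rows are indexed by the coordinates of \<open>ker Ha\<close>, columns by those
    of \<open>ker Hb\<close>.\<close>
  define I where "I = {i. ?P $ i \<noteq> 0} \<union> {i. ?A $ i \<noteq> 0}"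
  define J where "J = {j. transpose ?Q $ j \<noteq> 0} \<union> {j. transpose ?B $ j \<noteq> 0}"
  have "card I \<le> hamming_weight (vec_of ?P) + hamming_weight (vec_of ?A)"
    unfolding I_def using card_nonzero_rows_le[of ?P] card_nonzero_rows_le[of ?A]
    by (intro order_trans[OF card_Un_le] add_mono)
  then have cardI: "enat (card I) < ?d"
    by (intro le_less_trans[OF _ weight]) simp
  have "card J \<le> hamming_weight (vec_of ?Q) + hamming_weight (vec_of ?B)"
    unfolding J_def using card_nonzero_columns_le[of ?Q] card_nonzero_columns_le[of ?B]
    by (intro order_trans[OF card_Un_le] add_mono)
  then have cardJ: "enat (card J) < ?d"
    by (intro le_less_trans[OF _ weight]) simp
  have P: "erase_coords I ** ?P = 0" and A: "erase_coords I ** ?A = 0"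
    by (rule erase_coords_mult_eq_0; simp add: I_def)+
  have Q: "?Q ** transpose (erase_coords J) = 0" and B: "?B ** transpose (erase_coords J) = 0"
    unfolding transpose_erase_coords by (rule mult_erase_coords_eq_0; simp add: J_def)+
  \<comment> \<open>Transposing exchanges the two factors, so that the lemmas about the second block
    also serve the first.\<close>
  have P': "(transpose P + Hb' ** transpose U) ** transpose (erase_coords I) = 0"
    using arg_cong[OF P, of transpose] by (simp add: matrix_transpose_mul transpose_add)
  have A': "Hb ** transpose U ** transpose (erase_coords I) = 0"
    using arg_cong[OF A, of transpose] by (simp add: matrix_transpose_mul transpose_add)
  have z': "Hb ** transpose Q + transpose P ** transpose Ha = 0"
    using arg_cong[OF z, of transpose] by (simp add: matrix_transpose_mul transpose_add add.commute)
  obtain Ga where Ga: "Ha ** Ga ** Ha = Ha" by (rule generalized_inverse_exists)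
  obtain Gb where Gb: "Hb ** Gb ** Hb = Hb" by (rule generalized_inverse_exists)
  have inja: "\<forall>k. Ha *v k = 0 \<longrightarrow> erase_coords I *v k = 0 \<longrightarrow> k = 0" if "Hb ** Gb \<noteq> mat 1"
    using erase_coords_inj_on_ker[OF css_distance_le_ker_a[OF Gb that] cardI] by blast
  have injb: "\<forall>k. Hb *v k = 0 \<longrightarrow> erase_coords J *v k = 0 \<longrightarrow> k = 0" if "Ha ** Ga \<noteq> mat 1"
    using erase_coords_inj_on_ker[OF css_distance_le_ker_b[OF Ga that] cardJ] by blast
  \<comment> \<open>\<open>X\<close> and \<open>Y\<close> may differ here: the corrected pair is
    still a cycle, so a single \<open>W\<close> can be found afterwards.\<close>
  have "\<exists>K X Y. Ha ** K = 0 \<and> K ** transpose Hb = 0 \<and>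
    P + K ** transpose Hb' = X ** transpose Hb \<and> Q + Ha' ** K = Ha ** Y"
  proof (cases "Ha ** Ga = mat 1")
    case a: True
    then have aY: "M = Ha ** (Ga ** M)" for M :: "bit^'nb^'ma"
      by (simp add: matrix_mul_assoc)
    show ?thesis
    proof (cases "Hb ** Gb = mat 1")
      case True
      then have "transpose Gb ** transpose Hb = mat 1"
        by (metis matrix_transpose_mul transpose_mat)
      then have "P = P ** transpose Gb ** transpose Hb"
        by (simp add: matrix_mul_assoc[symmetric])
      then show ?thesis
        using aY[of Q] by (intro exI[of _ 0] exI[of _ "P ** transpose Gb"] exI[of _ "Ga ** Q"]) simp
    next
      case False
      from exists_gauge_correction_one_side[OF inja[OF False] z' A' P']
      obtain K Y where K: "Hb ** K = 0" "K ** transpose Ha = 0" "transpose P + Hb' ** K = Hb ** Y"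
        by blast
      have "Ha ** transpose K = 0" "transpose K ** transpose Hb = 0"
        "P + transpose K ** transpose Hb' = transpose Y ** transpose Hb"
        using K[THEN arg_cong[where f = transpose]]
        by (simp_all add: matrix_transpose_mul transpose_add)
      then show ?thesis using aY[of "Q + Ha' ** transpose K"] by blast
    qed
  next
    case a: False
    show ?thesis
    proof (cases "Hb ** Gb = mat 1")
      case True
      then have "transpose Gb ** transpose Hb = mat 1"
        by (metis matrix_transpose_mul transpose_mat)
      then have bX: "M = (M ** transpose Gb) ** transpose Hb" for M :: "bit^'mb^'na"
        by (simp add: matrix_mul_assoc[symmetric])
      from exists_gauge_correction_one_side[OF injb[OF a] z B Q]
      obtain K Y where "Ha ** K = 0" "K ** transpose Hb = 0" "Q + Ha' ** K = Ha ** Y"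
        by blast
      then show ?thesis using bX[of "P + K ** transpose Hb'"] by blast
    next
      case False
      \<comment> \<open>Neither factor is surjective, so one \<open>K\<close> has to correct both
        blocks; it replaces \<open>U\<close> in the low-weight conditions.\<close>
      from exists_ker_product_agreeing[OF inja[OF False] injb[OF a] A B]
      obtain K where K: "Ha ** K = 0" "K ** transpose Hb = 0"
        "erase_coords I ** K = erase_coords I ** U"
        "K ** transpose (erase_coords J) = U ** transpose (erase_coords J)"
        by blast
      have KI: "transpose K ** erase_coords I = transpose U ** erase_coords I"
        using arg_cong[OF K(3), of transpose] by (simp add: matrix_transpose_mul)
      have "(Q + Ha' ** K) ** transpose (erase_coords J) = 0"
        using Q by (simp add: matrix_add_rdistrib matrix_mul_assoc[symmetric] K(4) del: transpose_erase_coords)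
      from corrected_in_range[OF injb[OF a] z K(2) this]
      obtain Y where Y: "Q + Ha' ** K = Ha ** Y" by blast
      have "(transpose P + Hb' ** transpose K) ** transpose (erase_coords I) = 0"
        using P' by (simp add: matrix_add_rdistrib matrix_mul_assoc[symmetric] KI)
      moreover have "transpose K ** transpose Ha = 0"
        by (metis K(1) matrix_transpose_mul transpose_0)
      ultimately obtain X where "transpose P + Hb' ** transpose K = Hb ** X"
        using corrected_in_range[OF inja[OF False] z'] by blast
      then have "P + K ** transpose Hb' = transpose X ** transpose Hb"
        by (metis matrix_transpose_mul transpose_add transpose_transpose)
      with K(1,2) Y show ?thesis by blast
    qed
  qed
  then obtain K X Y where K: "Ha ** K = 0" "K ** transpose Hb = 0"
    "P + K ** transpose Hb' = X ** transpose Hb" "Q + Ha' ** K = Ha ** Y"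
    by blast
  have "Ha ** (P + K ** transpose Hb') + (Q + Ha' ** K) ** transpose Hb = 0"
    using z K(1) K(2)
    by (simp add: matrix_add_ldistrib matrix_add_rdistrib matrix_mul_assoc)
      (simp add: matrix_mul_assoc[symmetric])
  from cycle_in_ranges_is_boundary[OF this K(3,4)] obtain W where
    "P + K ** transpose Hb' = W ** transpose Hb" "Q + Ha' ** K = Ha ** W" by blast
  with K(1,2) show thesis by (rule that)
qed

section \<open>Weight bounds for the merged code\<close>

lemma merged_Z_nontrivial_weight:
  fixes Ha Ha' :: "bit^'na^'ma" and Hb Hb' :: "bit^'nb^'mb"
  assumes v: "v \<in> merged_Z_nontrivial (hgp_X Ha Hb) (hgp_Z Ha Hb) (hgp_Z Ha' Hb')"
  shows "css_distance (hgp_X Ha Hb) (hgp_Z Ha Hb) \<le> hamming_weight v"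
proof (rule ccontr)
  let ?T = "transpose (hgp_Z Ha Hb)" and ?T' = "transpose (hgp_Z Ha' Hb')"
  assume "\<not> ?thesis"
  then have less: "enat (hamming_weight v) < css_distance (hgp_X Ha Hb) (hgp_Z Ha Hb)"
    by simp
  obtain z u where zu: "hgp_X Ha Hb *v z = 0" "v = stack z 0 + stack ?T' ?T *v u"
    using v by (auto simp: merged_Z_nontrivial_def merged_Z_logicals_def ker_def)
  obtain U where u: "u = vec_of U" by (rule vec_of_surj)
  obtain P Q where z: "z = stack (vec_of P) (vec_of Q)" by (metis stack_surj vec_of_surj)
  have ker: "Ha ** P + Q ** transpose Hb = 0"
    using zu(1) by (simp add: z hgp_X_mult)
  have v_eq: "v = stack (z + ?T' *v u) (?T *v u)"
    by (simp add: zu(2) stack_mult stack_add)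
  have "v = stack (stack (vec_of (P + U ** transpose Hb')) (vec_of (Q + Ha' ** U)))
      (stack (vec_of (U ** transpose Hb)) (vec_of (Ha ** U)))"
    by (simp add: v_eq z u transpose_hgp_Z_mult stack_add vec_of_add)
  then obtain K W where K: "Ha ** K = 0" "K ** transpose Hb = 0"
    "P + K ** transpose Hb' = W ** transpose Hb" "Q + Ha' ** K = Ha ** W"
    using merged_Z_low_weight_trivial[OF ker, where U = U and Hb' = Hb' and Ha' = Ha'] less
    by (auto simp: hamming_weight_stack add.assoc)
  have k: "?T *v vec_of K = 0"
    by (simp add: transpose_hgp_Z_mult K)
  have w: "?T *v vec_of W = z + ?T' *v vec_of K"
    by (simp add: transpose_hgp_Z_mult z K stack_add vec_of_add[symmetric])
  \<comment> \<open>Shifting \<open>u\<close> by \<open>K\<close> leaves the auxiliary block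
    unchanged, and in the data block the two copies of the \<open>K\<close> term cancel.\<close>
  have "?T *v vec_of W + ?T' *v (u + vec_of K) =
      z + ?T' *v u + (?T' *v vec_of K + ?T' *v vec_of K)"
    by (simp only: w matrix_vector_right_distrib add_ac)
  then have "v = transpose (merged_Z (hgp_Z Ha Hb) (hgp_Z Ha' Hb')) *v stack (vec_of W) (u + vec_of K)"
    by (simp add: v_eq transpose_merged_Z stack_mult beside_mult_stack matrix_vector_right_distrib k)
  then have "v \<in> im (transpose (merged_Z (hgp_Z Ha Hb) (hgp_Z Ha' Hb')))"
    unfolding im_def by blast
  with v show False by (simp add: merged_Z_nontrivial_def)
qed

lemma merged_X_nontrivial_weight:
  fixes HX HX' :: "bit^'q^'x" and HZ HZ' :: "bit^'q^'z"
  assumes commute: "\<And>a. HZ' *v (transpose HX *v a) = HZ *v (transpose HX' *v a)"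
    and w: "w \<in> merged_X_nontrivial HX HZ HX' HZ'"
  shows "css_distance HX HZ \<le> hamming_weight w"
proof -
  obtain x y where w_eq: "w = stack x y" by (rule stack_surj)
  have xy: "HZ *v x = 0" "HZ' *v x + HZ *v y = 0"
    using w by (simp_all add: w_eq merged_X_nontrivial_def merged_X_logicals_def ker_def merged_Z_def
        stack_mult beside_mult_stack)
  have "x \<notin> im (transpose HX)"
  proof
    assume "x \<in> im (transpose HX)"
    then obtain a where a: "x = transpose HX *v a" by (auto simp: im_def)
    \<comment> \<open>Removing the combination of rows with coefficients \<open>a\<close> from
      \<open>w\<close> leaves \<open>stack 0 g\<close>, a fixed gauge by commutation.\<close>
    define g where "g = transpose HX' *v a + y"
    have "HZ *v g = 0"
      using xy(2) by (simp add: g_def matrix_vector_right_distrib commute[symmetric] a)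
    then have "stack 0 g \<in> vec.span (rows (beside HX HX') \<union> {stack 0 g | g. g \<in> ker HZ})"
      by (intro vec.span_base) (auto simp: ker_def)
    moreover have "transpose (beside HX HX') *v a \<in> vec.span (rows (beside HX HX') \<union> {stack 0 g | g. g \<in> ker HZ})"
      using matrix_vector_mult_in_columnspace_gen[of "transpose (beside HX HX')" a]
      by (metis (no_types, lifting) columns_transpose subsetD sup_ge1 vec.span_mono)
    ultimately have "transpose (beside HX HX') *v a + stack 0 g
        \<in> vec.span (rows (beside HX HX') \<union> {stack 0 g | g. g \<in> ker HZ})"
      by (intro vec.span_add)
    moreover have "transpose (beside HX HX') *v a + stack 0 g = w"
      by (simp add: w_eq a g_def transpose_beside stack_mult stack_add add.assoc[symmetric])
    ultimately show False
      using w by (simp add: merged_X_nontrivial_def)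
  qed
  then have "css_distance HX HZ \<le> hamming_weight x"
    using xy(1) unfolding css_distance_def min_weight_def by (intro INF_lower) (auto simp: ker_def)
  also have "\<dots> \<le> hamming_weight w"
    by (simp add: w_eq hamming_weight_stack)
  finally show ?thesis .
qed

theorem mainTheorem9:
  fixes Ha Ha' :: "bit^'na^'ma" and Hb Hb' :: "bit^'nb^'mb"
    and HX HX' :: "bit^(('na \<times> 'mb) + ('ma \<times> 'nb))^('ma \<times> 'mb)"
    and HZ HZ' :: "bit^(('na \<times> 'mb) + ('ma \<times> 'nb))^('na \<times> 'nb)"
    and d :: enat
  assumes "HX = hgp_X Ha Hb" and "HZ = hgp_Z Ha Hb"
    and "HX' = hgp_X Ha' Hb'" and "HZ' = hgp_Z Ha' Hb'"
    and "d = css_distance HX HZ"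
  shows "d \<le> min_weight (merged_X_nontrivial HX HZ HX' HZ') \<and>
         d \<le> min_weight (merged_Z_nontrivial HX HZ HZ')"
proof
  show "d \<le> min_weight (merged_X_nontrivial HX HZ HX' HZ')"
    unfolding min_weight_def assms
    by (rule INF_greatest, rule merged_X_nontrivial_weight[OF hgp_commute])
  show "d \<le> min_weight (merged_Z_nontrivial HX HZ HZ')"
    unfolding min_weight_def assms
    by (rule INF_greatest, rule merged_Z_nontrivial_weight)
qed

end
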